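(* Let $L>\mu>0$ and let $f:H\to\mathbb{R}$ be convex, $L$-smooth, attain its minimum value $f^*$, and satisfy the Polyak-Łojasiewicz inequality $\|\nabla f(x)\|^2\ge 2\mu\left(f(x)-f^*\right)$ for all $x\in H$. Set $q=\mu/L$ and $$h=\frac{1}{\sqrt L},\qquad \alpha h=\frac{2q}{1+\sqrt{2q-q^2}},\qquad \gamma=\frac{\sqrt{2q-q^2}-q}{1-q}.$$ Given $x_0,y_0\in H$, let $(x_k)$ and $(y_k)$ be generated, for $k\ge 0$, by $$y_{k+1}=x_k-h^2\nabla f(x_k),\qquad x_{k+1}=y_{k+1}+\frac{1}{1+\alpha h}(y_{k+1}-y_k)+\left(\frac{\gamma}{1+\alpha h}-1\right)(y_{k+1}-x_k).$$ If $y_0=-(\gamma-\alpha h)h^2\nabla f(x_0)+x_0$, then for every $k\ge 1$, $$f(y_k)-f^*\le\left(f(x_0)-f^*\right)(1+\rho)^{-k+1},$$ where $\rho=\frac{2q}{1+\sqrt{2q-q^2}}$.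
   Context: $H$ is a real Hilbert space with norm $\|\cdot\|$. $f$ is $L$-smooth if it is differentiable and $\nabla f$ is Lipschitz-continuous with constant $L$. $f^*=\min(f)$; the minimizer need not be unique. *)

theory Defs
  imports "HOL-Analysis.Analysis"
begin

text \<open>A real Hilbert space is a type of sort \<open>{real_inner, complete_space}\<close>.\<close>

definition gradient :: "('a::real_inner \<Rightarrow> real) \<Rightarrow> 'a \<Rightarrow> 'a"
  where "gradient f x = (THE D. GDERIV f x :> D)"

definition L_smooth :: "real \<Rightarrow> ('a::{real_inner,complete_space} \<Rightarrow> real) \<Rightarrow> bool"
  where "L_smooth L f \<longleftrightarrow> (\<forall>x. f differentiable (at x)) \<and> L-lipschitz_on UNIV (gradient f)"

definition PL_inequality :: "real \<Rightarrow> ('a::real_inner \<Rightarrow> real) \<Rightarrow> real \<Rightarrow> bool"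
  where "PL_inequality \<mu> f fstar \<longleftrightarrow> (\<forall>x. (norm (gradient f x))\<^sup>2 \<ge> 2 * \<mu> * (f x - fstar))"

text \<open>The definite description in \<open>gradient\<close> is meaningful: at a point of (Frechet)
  differentiability the Riesz representation theorem gives existence.\<close>

lemma riesz_representation:
  fixes F :: "'a::{real_inner,complete_space} \<Rightarrow> real"
  assumes "bounded_linear F"
  shows "\<exists>w. \<forall>y. F y = inner y w"
proof -
  interpret F: bounded_linear F by fact
  define \<phi> where "\<phi> u = F u - (norm u)\<^sup>2 / 2" for u
  define S where "S = (SUP u. \<phi> u)"
  obtain C where C: "\<And>u. norm (F u) \<le> norm u * C" using F.bounded by blast
  have bound: "\<phi> u \<le> C\<^sup>2 / 2" for u
  proof -
    have "0 \<le> (norm u - C)\<^sup>2" by simp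
    then have "norm u * C \<le> (norm u)\<^sup>2 / 2 + C\<^sup>2 / 2"
      by (simp add: power2_eq_square algebra_simps)
    with C[of u] show ?thesis by (simp add: \<phi>_def)
  qed
  have bdd: "bdd_above (range \<phi>)" using bound by (rule bdd_aboveI2)
  have le_S: "\<phi> u \<le> S" for u unfolding S_def by (rule cSUP_upper[OF _ bdd]) simp
  have "\<exists>u. S - inverse (real (Suc n)) < \<phi> u" for n
  proof -
    have "S - inverse (real (Suc n)) < S" by simp
    then show ?thesis unfolding S_def using less_cSUP_iff[OF _ bdd] by blast
  qed
  then obtain U where U: "\<And>n. S - inverse (real (Suc n)) < \<phi> (U n)" by metis
  have par: "(norm (u - v))\<^sup>2 \<le> 4 * (2 * S - \<phi> u - \<phi> v)" for u v
  proof -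
    have "(norm ((1/2) *\<^sub>R (u + v)))\<^sup>2 = (norm (u + v))\<^sup>2 / 4"
      by (simp add: power_mult_distrib power_divide)
    moreover have "(norm (u + v))\<^sup>2 + (norm (u - v))\<^sup>2 = 2 * (norm u)\<^sup>2 + 2 * (norm v)\<^sup>2"
      by (simp add: power2_norm_eq_inner inner_add_left inner_add_right
          inner_diff_left inner_diff_right inner_commute)
    moreover have "F ((1/2) *\<^sub>R (u + v)) = (F u + F v) / 2"
      by (simp only: F.scaleR F.add) simp
    ultimately have "\<phi> ((1/2) *\<^sub>R (u + v)) = (\<phi> u + \<phi> v) / 2 + (norm (u - v))\<^sup>2 / 8"
      unfolding \<phi>_def by argo
    with le_S[of "(1/2) *\<^sub>R (u + v)"] show ?thesis by argo
  qed
  have "Cauchy U"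
  proof (rule metric_CauchyI)
    fix e :: real assume "0 < e"
    then have "0 < e\<^sup>2 / 8" by simp
    then obtain N where N: "inverse (real (Suc N)) < e\<^sup>2 / 8" using reals_Archimedean by blast
    have *: "S - \<phi> (U n) < e\<^sup>2 / 8" if "n \<ge> N" for n
    proof -
      have "inverse (real (Suc n)) \<le> inverse (real (Suc N))"
        using that by (intro le_imp_inverse_le) auto
      with U[of n] N show ?thesis by linarith
    qed
    have "dist (U m) (U n) < e" if "m \<ge> N" "n \<ge> N" for m n
    proof -
      have "(norm (U m - U n))\<^sup>2 < e\<^sup>2"
        using par[of "U m" "U n"] *[OF that(1)] *[OF that(2)] by argo
      with \<open>0 < e\<close> show ?thesis by (simp add: dist_norm power2_less_imp_less)
    qed
    then show "\<exists>M. \<forall>m\<ge>M. \<forall>n\<ge>M. dist (U m) (U n) < e" by blast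
  qed
  then obtain w where w: "U \<longlonglongrightarrow> w" using Cauchy_convergent convergent_def by blast
  have "(\<lambda>n. \<phi> (U n)) \<longlonglongrightarrow> \<phi> w" unfolding \<phi>_def
    by (intro tendsto_intros F.tendsto w) simp
  moreover have "(\<lambda>n. S - inverse (real (Suc n))) \<longlonglongrightarrow> S - 0"
    by (intro tendsto_intros LIMSEQ_inverse_real_of_nat)
  ultimately have "S \<le> \<phi> w"
    using U by (intro LIMSEQ_le[where X = "\<lambda>n. S - inverse (real (Suc n))"]) (auto intro: less_imp_le)
  have "F y = inner y w" for y
  proof (cases "y = 0")
    case False
    define c where "c = F y - inner y w"
    define t where "t = c / inner y y"
    have yy: "inner y y > 0" using False by simp
    have "\<phi> (w + t *\<^sub>R y) \<le> \<phi> w" using le_S \<open>S \<le> \<phi> w\<close> order_trans by blast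
    moreover have "\<phi> (w + t *\<^sub>R y) = \<phi> w + t * c - t\<^sup>2 * inner y y / 2"
    proof -
      have "(norm (w + t *\<^sub>R y))\<^sup>2
          = (norm w)\<^sup>2 + 2 * (t * inner y w) + t\<^sup>2 * inner y y"
        unfolding power2_norm_eq_inner
        by (simp add: inner_add_left inner_add_right inner_commute power2_eq_square)
      moreover have "F (w + t *\<^sub>R y) = F w + t * F y" by (simp add: F.scaleR F.add)
      ultimately show ?thesis unfolding \<phi>_def c_def right_diff_distrib by argo
    qed
    moreover have "t * c - t\<^sup>2 * inner y y / 2 = c\<^sup>2 / (2 * inner y y)"
      using yy by (simp add: t_def power2_eq_square field_simps)
    ultimately have "c\<^sup>2 / (2 * inner y y) \<le> 0" by linarith
    moreover have "0 < 2 * inner y y" using yy by linarith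
    ultimately have "c\<^sup>2 \<le> 0" by (meson not_le divide_pos_pos)
    then have "c = 0" by simp
    then show ?thesis by (simp add: c_def)
  qed (simp add: F.zero)
  then show ?thesis by blast
qed

lemma gradient_eqI:
  assumes "GDERIV f x :> D"
  shows "gradient f x = D"
  unfolding gradient_def
proof (rule the_equality)
  fix E assume "GDERIV f x :> E"
  with assms have "(\<lambda>h. inner h E) = (\<lambda>h. inner h D)"
    unfolding gderiv_def by (metis has_derivative_unique)
  then have "inner (E - D) (E - D) = 0"
    by (metis inner_diff_right right_minus_eq)
  then show "E = D" by simp
qed (fact assms)

lemma GDERIV_gradient:
  fixes f :: "'a::{real_inner,complete_space} \<Rightarrow> real"
  assumes "f differentiable (at x)"
  shows "GDERIV f x :> gradient f x"
proof -
  from assms obtain F where F: "(f has_derivative F) (at x)"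
    by (auto simp: differentiable_def)
  with riesz_representation[OF has_derivative_bounded_linear] obtain w
    where "\<And>y. F y = inner y w" by blast
  then have "F = (\<lambda>y. inner y w)" by (rule ext)
  with F have "GDERIV f x :> w" unfolding gderiv_def by simp
  then show ?thesis using gradient_eqI by metis
qed

end

theory Submission
  imports Defs
begin

text \<open>With \<open>a = \<alpha>h\<close> and \<open>p\<^sub>k = x\<^sub>k - y\<^sub>k\<close> the scheme reads
  \<open>x\<^sub>k\<^sub>+\<^sub>1 = x\<^sub>k - h\<^sup>2\<nabla>f(x\<^sub>k) + p\<^sub>k\<^sub>+\<^sub>1\<close>,
  \<open>(1 + a) p\<^sub>k\<^sub>+\<^sub>1 = p\<^sub>k - (\<gamma> - a) h\<^sup>2\<nabla>f(x\<^sub>k)\<close>, and the choice of \<open>y\<^sub>0\<close> means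
  \<open>p\<^sub>1 = 0\<close>. Moreover \<open>a = \<gamma>\<^sup>2\<close>. By co-coercivity between \<open>x\<^sub>k\<close> and \<open>x\<^sub>k\<^sub>+\<^sub>1\<close> together with the
  Polyak-Lojasiewicz inequality at \<open>x\<^sub>k\<^sub>+\<^sub>1\<close>, the energy
  \<open>f(x\<^sub>k) - f* - |\<nabla>f(x\<^sub>k)|\<^sup>2/(2L) + (cL/2) |p\<^sub>k\<^sub>+\<^sub>1|\<^sup>2\<close> with \<open>c = (1 + a)/(\<gamma>(1 - \<gamma>))\<close>, for which
  the mixed terms \<open>\<langle>\<nabla>f(x\<^sub>k\<^sub>+\<^sub>1), p\<^sub>k\<^sub>+\<^sub>1\<rangle>\<close> cancel, contracts by the factor \<open>1/(1 + a)\<close> in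
  each step. It dominates \<open>f(y\<^sub>k\<^sub>+\<^sub>1) - f*\<close> by the descent lemma, and initially it is at most
  \<open>f(x\<^sub>0) - f*\<close>.\<close>

lemma GDERIV_along_line:
  assumes "GDERIV f (x + t *\<^sub>R d) :> D"
  shows "((\<lambda>t. f (x + t *\<^sub>R d)) has_real_derivative inner d D) (at t)"
proof -
  have "((\<lambda>t. x + t *\<^sub>R d) has_derivative (\<lambda>s. s *\<^sub>R d)) (at t)"
    by (auto intro!: derivative_eq_intros)
  from has_derivative_compose[OF this assms[unfolded gderiv_def]]
  show ?thesis
    by (simp add: has_field_derivative_def mult_commute_abs)
qed

text \<open>Along \<open>x + t *\<^sub>R d\<close> the gap between \<open>f\<close> and the
  quadratic model has a derivative that compares the gradients at \<open>x + t *\<^sub>R d\<close>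
  and \<open>x\<close>. Cauchy-Schwarz and the Lipschitz bound make it nonpositive.\<close>

lemma L_smooth_descent:
  assumes "L_smooth L f"
  shows "f (x + d) \<le> f x + inner (gradient f x) d + L / 2 * (norm d)\<^sup>2"
proof -
  define \<phi> where "\<phi> t = f (x + t *\<^sub>R d) - t * inner d (gradient f x) - L / 2 * t\<^sup>2 * (norm d)\<^sup>2" for t
  have "\<phi> 1 \<le> \<phi> 0"
  proof (rule DERIV_nonpos_imp_nonincreasing[where f = \<phi>])
    fix t :: real assume t: "0 \<le> t" "t \<le> 1"
    let ?D = "inner d (gradient f (x + t *\<^sub>R d)) - inner d (gradient f x) - L * t * (norm d)\<^sup>2"
    have "(\<phi> has_real_derivative ?D) (at t)"
      unfolding \<phi>_def using assms
      by (auto intro!: derivative_eq_intros GDERIV_along_line GDERIV_gradient simp: L_smooth_def)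
    moreover have "?D \<le> 0"
    proof -
      have "norm (gradient f (x + t *\<^sub>R d) - gradient f x) \<le> L * norm (t *\<^sub>R d)"
        using assms lipschitz_onD[of L UNIV "gradient f" "x + t *\<^sub>R d" x]
        by (simp add: L_smooth_def dist_norm)
      then have "norm d * norm (gradient f (x + t *\<^sub>R d) - gradient f x) \<le> norm d * (L * norm (t *\<^sub>R d))"
        by (rule mult_left_mono) simp
      with norm_cauchy_schwarz
      have "inner d (gradient f (x + t *\<^sub>R d) - gradient f x) \<le> norm d * (L * norm (t *\<^sub>R d))"
        by (rule order_trans)
      then show "?D \<le> 0"
        using t by (simp add: inner_diff_right power2_eq_square mult_ac)
    qed
    ultimately show "\<exists>D. (\<phi> has_real_derivative D) (at t) \<and> D \<le> 0" by blast
  qed simp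
  then show ?thesis by (simp add: \<phi>_def inner_commute)
qed

lemma convex_on_above_gradient:
  fixes f :: "'a::real_inner \<Rightarrow> real"
  assumes "convex_on UNIV f" and "GDERIV f x :> D"
  shows "f x + inner D (z - x) \<le> f z"
proof -
  let ?\<phi> = "\<lambda>t. f (x + t *\<^sub>R (z - x))"
  have "convex_on UNIV ?\<phi>"
  proof (rule convex_onI)
    fix t s r :: real assume "0 < t" "t < 1"
    moreover have "x + ((1 - t) *\<^sub>R s + t *\<^sub>R r) *\<^sub>R (z - x)
        = (1 - t) *\<^sub>R (x + s *\<^sub>R (z - x)) + t *\<^sub>R (x + r *\<^sub>R (z - x))"
      by (simp add: algebra_simps)
    ultimately show "?\<phi> ((1 - t) *\<^sub>R s + t *\<^sub>R r) \<le> (1 - t) * ?\<phi> s + t * ?\<phi> r"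
      using convex_onD[OF assms(1)] by simp
  qed simp
  moreover have "(?\<phi> has_real_derivative inner (z - x) D) (at 0)"
    using assms(2) by (intro GDERIV_along_line) simp
  ultimately have "?\<phi> 1 - ?\<phi> 0 \<ge> inner (z - x) D * (1 - 0)"
    by (intro convex_on_imp_above_tangent[where A = UNIV]) auto
  then show ?thesis by (simp add: inner_commute)
qed

lemma L_smooth_convex_cocoercive:
  assumes "L > 0" and "L_smooth L f" and "convex_on UNIV f"
  shows "f y + inner (gradient f y) (x - y)
      + (norm (gradient f x - gradient f y))\<^sup>2 / (2 * L) \<le> f x"
proof -
  define w where "w = gradient f x - gradient f y"
  \<comment> \<open>The point \<open>z\<close> minimizes the quadratic upper model of
    \<open>f\<close> at \<open>x\<close> minus the tangent of \<open>f\<close> at \<open>y\<close>.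
    Chaining tangent and descent bounds there leaves the squared gradient difference.\<close>
  define z where "z = x + (- 1 / L) *\<^sub>R w"
  have "f y + inner (gradient f y) (z - y) \<le> f z"
    using assms by (intro convex_on_above_gradient GDERIV_gradient) (simp_all add: L_smooth_def)
  also have "f z \<le> f x + inner (gradient f x) ((- 1 / L) *\<^sub>R w) + L / 2 * (norm ((- 1 / L) *\<^sub>R w))\<^sup>2"
    unfolding z_def by (rule L_smooth_descent[OF assms(2)])
  finally have *: "f y + inner (gradient f y) (x - y) - inner (gradient f y) w / L
      \<le> f x - inner (gradient f x) w / L + L / 2 * ((norm w)\<^sup>2 / L\<^sup>2)"
    by (simp add: z_def inner_diff_right inner_add_right power_divide algebra_simps)
  have "inner (gradient f x) w - inner (gradient f y) w = (norm w)\<^sup>2"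
    by (simp add: w_def power2_norm_eq_inner inner_diff_left)
  then have "inner (gradient f x) w / L - inner (gradient f y) w / L = (norm w)\<^sup>2 / L"
    by (simp add: diff_divide_distrib[symmetric])
  moreover have "L / 2 * ((norm w)\<^sup>2 / L\<^sup>2) = (norm w)\<^sup>2 / L / 2"
    using assms(1) by (simp add: power2_eq_square)
  moreover have "(norm w)\<^sup>2 / (2 * L) = (norm w)\<^sup>2 / L / 2" by simp
  ultimately show ?thesis using * unfolding w_def[symmetric] by argo
qed

text \<open>Since s^2 = 1 - (1 - q)^2, numerator and denominator of \<gamma>^2 share the factor 1 -
  s. The last inequality is the sign condition on |u|^2 in the energy step; it follows from \<gamma>
  \<le> s and \<gamma>^2/q = 2/(1 + s) \<le> 2 - s.\<close>

lemma momentum_parameters: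
  fixes q s \<gamma> :: real
  assumes "0 < q" "q < 1" and s: "s = sqrt (2 * q - q\<^sup>2)" and \<gamma>: "\<gamma> = (s - q) / (1 - q)"
  shows "2 * q / (1 + s) = \<gamma>\<^sup>2" and "0 < \<gamma>" and "\<gamma> < 1"
    and "\<gamma>\<^sup>2 / q - 2 + \<gamma> - 2 * \<gamma>\<^sup>2 \<le> 0"
proof -
  have "q\<^sup>2 < q" using assms by (simp add: power2_eq_square)
  then have s2: "s\<^sup>2 = 2 * q - q\<^sup>2" using assms by simp
  have "q < s" unfolding s by (rule real_less_rsqrt) (use \<open>q\<^sup>2 < q\<close> in linarith)
  have "0 < (1 - q)\<^sup>2" using assms by simp
  then have "s\<^sup>2 < 1\<^sup>2" using s2 by (simp add: power2_diff)
  then have "s < 1" using power2_less_imp_less by fastforce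
  show "0 < \<gamma>" "\<gamma> < 1" using \<open>q < s\<close> \<open>s < 1\<close> assms(2) by (auto simp: \<gamma> divide_less_eq)
  have "(s - q)\<^sup>2 = 2 * q * (1 - s)"
    using s2 by (simp add: power2_diff algebra_simps)
  moreover have "(1 - q)\<^sup>2 = (1 - s) * (1 + s)"
    using s2 by (simp add: power2_diff algebra_simps power2_eq_square)
  ultimately show *: "2 * q / (1 + s) = \<gamma>\<^sup>2"
    using \<open>s < 1\<close> by (simp add: \<gamma> power_divide)
  have "s * q \<le> q" using \<open>s < 1\<close> assms by simp
  then have "\<gamma> \<le> s" using assms(2) by (simp add: \<gamma> field_simps)
  moreover have "\<gamma>\<^sup>2 / q \<le> 2 - s"
  proof -
    have "0 \<le> s * (1 - s)" using \<open>s < 1\<close> \<open>q < s\<close> assms(1) by simp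
    then have "2 \<le> (2 - s) * (1 + s)" by (simp add: algebra_simps)
    then have "2 / (1 + s) \<le> 2 - s" using \<open>q < s\<close> assms(1) by (simp add: pos_divide_le_eq)
    then show ?thesis using assms(1) by (simp add: *[symmetric])
  qed
  moreover have "0 \<le> \<gamma>\<^sup>2" by simp
  ultimately show "\<gamma>\<^sup>2 / q - 2 + \<gamma> - 2 * \<gamma>\<^sup>2 \<le> 0" by argo
qed

text \<open>One step of the scheme after division by L: \<open>F'\<close>, \<open>u\<close> and
  \<open>p\<close> belong to the new point, \<open>p'\<close> is the next momentum, and
  \<open>F\<close> stands for the old gap already reduced by half the squared old scaled
  gradient.\<close>

lemma momentum_energy_step:
  fixes p' p u :: "'a::real_inner" and F F' q \<gamma> e :: real
  assumes "0 < q" and "0 < \<gamma>" "\<gamma> < 1"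
    and param: "\<gamma>\<^sup>2 / q - 2 + \<gamma> - 2 * \<gamma>\<^sup>2 \<le> 0"
    and coco: "F' - inner u p + (norm u)\<^sup>2 / 2 \<le> F"
    and PL: "2 * q * F' \<le> (norm u)\<^sup>2"
    and p': "(1 + \<gamma>\<^sup>2) *\<^sub>R p' = p - (\<gamma> * (1 - \<gamma>)) *\<^sub>R u"
    and c: "c = (1 + \<gamma>\<^sup>2) / (\<gamma> * (1 - \<gamma>))"
  shows "(1 + \<gamma>\<^sup>2) * (F' - (norm u)\<^sup>2 / 2 + c / 2 * (norm p')\<^sup>2) \<le> F + c / 2 * (norm p)\<^sup>2"
proof -
  define m where "m = \<gamma> * (1 - \<gamma>)"
  have "m > 0" using assms by (simp add: m_def)
  have "(norm ((1 + \<gamma>\<^sup>2) *\<^sub>R p'))\<^sup>2 = (norm p)\<^sup>2 - 2 * m * inner u p + m\<^sup>2 * (norm u)\<^sup>2"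
    unfolding p' m_def[symmetric] power2_norm_eq_inner
    by (simp add: inner_diff_left inner_diff_right inner_commute power2_eq_square algebra_simps)
  then have n: "(1 + \<gamma>\<^sup>2)\<^sup>2 * (norm p')\<^sup>2 = (norm p)\<^sup>2 - 2 * m * inner u p + m\<^sup>2 * (norm u)\<^sup>2"
    by (simp add: power_mult_distrib)
  \<comment> \<open>One factor \<open>1 + \<gamma>\<^sup>2\<close> is the contraction rate, the
    other comes from \<open>c\<close>. Dividing by \<open>m\<close> gives \<open>inner u p\<close>
    exactly the coefficient that \<open>coco\<close> absorbs.\<close>
  have "(1 + \<gamma>\<^sup>2) * (c * (norm p')\<^sup>2) = (1 + \<gamma>\<^sup>2)\<^sup>2 * (norm p')\<^sup>2 / m"
    by (simp add: c m_def power2_eq_square)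
  also have "\<dots> = (norm p)\<^sup>2 / m - 2 * inner u p + m * (norm u)\<^sup>2"
    unfolding n using \<open>m > 0\<close> by (simp add: field_simps power2_eq_square)
  finally have 1: "(1 + \<gamma>\<^sup>2) * (c * (norm p')\<^sup>2) = (norm p)\<^sup>2 / m - 2 * inner u p + m * (norm u)\<^sup>2" .
  have 2: "(norm p)\<^sup>2 / m \<le> c * (norm p)\<^sup>2"
    using \<open>m > 0\<close> by (simp add: c m_def[symmetric] divide_right_mono mult_right_mono
        mult_le_cancel_right1 field_simps)
  \<comment> \<open>Only the surplus \<gamma>^2 F' is paid for by the Polyak-Lojasiewicz inequality;
    the other copy of \<open>F'\<close> is kept for \<open>coco\<close>.\<close>
  have "F' \<le> (norm u)\<^sup>2 / (2 * q)" using PL assms(1) by (simp add: field_simps)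
  then have "\<gamma>\<^sup>2 * F' \<le> \<gamma>\<^sup>2 * ((norm u)\<^sup>2 / (2 * q))" by (rule mult_left_mono) simp
  then have 3: "2 * (\<gamma>\<^sup>2 * F') \<le> \<gamma>\<^sup>2 / q * (norm u)\<^sup>2" by simp
  have "(\<gamma>\<^sup>2 / q - 2 + \<gamma> - 2 * \<gamma>\<^sup>2) * (norm u)\<^sup>2 \<le> 0"
    using param by (simp add: mult_nonpos_nonneg)
  then have 4: "\<gamma>\<^sup>2 / q * (norm u)\<^sup>2 + m * (norm u)\<^sup>2 \<le> (2 + \<gamma>\<^sup>2) * (norm u)\<^sup>2"
    by (simp add: m_def algebra_simps power2_eq_square)
  have "2 * ((1 + \<gamma>\<^sup>2) * (F' - (norm u)\<^sup>2 / 2 + c / 2 * (norm p')\<^sup>2))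
      = 2 * F' + 2 * (\<gamma>\<^sup>2 * F') - (1 + \<gamma>\<^sup>2) * (norm u)\<^sup>2 + (1 + \<gamma>\<^sup>2) * (c * (norm p')\<^sup>2)"
    by (simp add: field_simps)
  also have "\<dots> \<le> 2 * F' - 2 * inner u p + (norm u)\<^sup>2 + c * (norm p)\<^sup>2"
    using 1 2 3 4 by (simp add: algebra_simps)
  also have "\<dots> \<le> 2 * F + c * (norm p)\<^sup>2" using coco by linarith
  finally show ?thesis by simp
qed

theorem theorem16:
  fixes f :: "'a::{real_inner,complete_space} \<Rightarrow> real"
    and L \<mu> q h \<alpha> \<gamma> \<rho> fstar :: real
    and x y :: "nat \<Rightarrow> 'a"
  assumes "L > \<mu>" and "\<mu> > 0"
    and "convex_on UNIV f"
    and "L_smooth L f"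
    and "fstar \<in> range f" and "\<And>z. fstar \<le> f z"
    and "PL_inequality \<mu> f fstar"
    and "q = \<mu> / L"
    and "h = 1 / sqrt L"
    and "\<alpha> * h = 2 * q / (1 + sqrt (2 * q - q\<^sup>2))"
    and "\<gamma> = (sqrt (2 * q - q\<^sup>2) - q) / (1 - q)"
    and "\<rho> = 2 * q / (1 + sqrt (2 * q - q\<^sup>2))"
    and "\<And>k. y (Suc k) = x k - h\<^sup>2 *\<^sub>R gradient f (x k)"
    and "\<And>k. x (Suc k) = y (Suc k) + (1 / (1 + \<alpha> * h)) *\<^sub>R (y (Suc k) - y k)
           + (\<gamma> / (1 + \<alpha> * h) - 1) *\<^sub>R (y (Suc k) - x k)"
    and "y 0 = - (((\<gamma> - \<alpha> * h) * h\<^sup>2) *\<^sub>R gradient f (x 0)) + x 0"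
  shows "\<forall>k\<ge>1. f (y k) - fstar \<le> (f (x 0) - fstar) * (1 + \<rho>) powi (- int k + 1)"
proof -
  have L: "L > 0" using assms(1,2) by simp
  have q: "0 < q" "q < 1" using assms(1,2) L by (simp_all add: assms(8))
  note par = momentum_parameters[OF q refl assms(11)]
  have a: "\<alpha> * h = \<gamma>\<^sup>2" "\<rho> = \<gamma>\<^sup>2" using assms(10,12) par(1) by simp_all
  have h2: "h\<^sup>2 = 1 / L" using L by (simp add: assms(9) power_divide)
  define u where "u k = (1 / L) *\<^sub>R gradient f (x k)" for k
  define p where "p k = x k - y k" for k
  define F where "F k = (f (x k) - fstar) / L" for k
  define c where "c = (1 + \<gamma>\<^sup>2) / (\<gamma> * (1 - \<gamma>))"
  \<comment> \<open>The index \<open>Suc k\<close> on the momentum is deliberate: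
    \<open>p (Suc k)\<close> is the part of the move from \<open>x k\<close> to
    \<open>x (Suc k)\<close> beyond the gradient step, and it vanishes at
    \<open>k = 0\<close>.\<close>
  define E where "E k = F k - (norm (u k))\<^sup>2 / 2 + c / 2 * (norm (p (Suc k)))\<^sup>2" for k
  have c: "0 \<le> c" using par by (simp add: c_def)
  have pos: "1 + \<gamma>\<^sup>2 > 0" by (simp add: add_pos_nonneg)
  have grad: "gradient f (x k) = L *\<^sub>R u k" for k using L by (simp add: u_def)
  have ySuc: "y (Suc k) = x k - u k" for k using assms(13)[of k] by (simp add: h2 u_def)
  have pSuc: "(1 + \<gamma>\<^sup>2) *\<^sub>R p (Suc k) = p k - (\<gamma> * (1 - \<gamma>)) *\<^sub>R u k" for k
  proof -
    have "p (Suc k) = (1 / (1 + \<gamma>\<^sup>2)) *\<^sub>R (p k - u k) - (\<gamma> / (1 + \<gamma>\<^sup>2) - 1) *\<^sub>R u k"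
      using assms(14)[of k] by (simp add: p_def a ySuc algebra_simps)
    then have "(1 + \<gamma>\<^sup>2) *\<^sub>R p (Suc k)
        = (p k - u k) - ((1 + \<gamma>\<^sup>2) * (\<gamma> / (1 + \<gamma>\<^sup>2) - 1)) *\<^sub>R u k"
      using pos by (simp only: scaleR_diff_right scaleR_scaleR) simp
    moreover have "(1 + \<gamma>\<^sup>2) * (\<gamma> / (1 + \<gamma>\<^sup>2) - 1) = \<gamma> - (1 + \<gamma>\<^sup>2)"
      using pos by (simp add: right_diff_distrib)
    ultimately show ?thesis by (simp add: algebra_simps power2_eq_square)
  qed
  \<comment> \<open>With \<alpha>h = \<gamma>^2 the factor \<gamma> - \<alpha>h in
    \<open>y 0\<close> is \<gamma>(1 - \<gamma>), the same factor as in \<open>pSuc\<close>, so the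
    first update cancels.\<close>
  have "p 0 = (\<gamma> * (1 - \<gamma>)) *\<^sub>R u 0"
    using assms(15) unfolding a h2 by (simp add: p_def u_def power2_eq_square right_diff_distrib)
  then have p1: "p (Suc 0) = 0" using pSuc[of 0] pos by simp
  have step: "(1 + \<gamma>\<^sup>2) * E (Suc k) \<le> E k" for k
    unfolding E_def
  \<comment> \<open>Here the lemma's \<open>F\<close> is
    \<open>F k - (norm (u k))\<^sup>2 / 2\<close>.\<close>
  proof (rule momentum_energy_step[OF q(1) par(2-4) _ _ pSuc c_def])
    have d: "x k - x (Suc k) = u k - p (Suc k)" by (simp add: p_def ySuc)
    have "f (x (Suc k)) + inner (L *\<^sub>R u (Suc k)) (u k - p (Suc k))
        + (norm (L *\<^sub>R (u k - u (Suc k))))\<^sup>2 / (2 * L) \<le> f (x k)"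
      using L_smooth_convex_cocoercive[OF L assms(4,3), of "x (Suc k)" "x k"]
      by (simp add: grad d scaleR_diff_right)
    moreover have "(norm (L *\<^sub>R (u k - u (Suc k))))\<^sup>2 / (2 * L)
        = L * ((norm (u k - u (Suc k)))\<^sup>2 / 2)"
      using L by (simp add: power_mult_distrib power2_eq_square)
    ultimately have "L * (inner (u (Suc k)) (u k - p (Suc k)) + (norm (u k - u (Suc k)))\<^sup>2 / 2)
        \<le> f (x k) - f (x (Suc k))"
      by (simp add: distrib_left)
    then have "inner (u (Suc k)) (u k - p (Suc k)) + (norm (u k - u (Suc k)))\<^sup>2 / 2
        \<le> F k - F (Suc k)"
      using L by (simp add: F_def diff_divide_distrib[symmetric] field_simps)
    \<comment> \<open>Expanding the square cancels \<open>inner (u (Suc k)) (u k)\<close>, so that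
      the momentum \<open>p (Suc k)\<close> is the only vector still paired with the new
      gradient.\<close>
    moreover have "(norm (u k - u (Suc k)))\<^sup>2
        = (norm (u k))\<^sup>2 - 2 * inner (u (Suc k)) (u k) + (norm (u (Suc k)))\<^sup>2"
      by (simp add: power2_norm_eq_inner inner_diff_left inner_diff_right inner_commute)
    ultimately show "F (Suc k) - inner (u (Suc k)) (p (Suc k)) + (norm (u (Suc k)))\<^sup>2 / 2
        \<le> F k - (norm (u k))\<^sup>2 / 2"
      unfolding inner_diff_right by argo
    have "2 * \<mu> * (f (x (Suc k)) - fstar) \<le> L\<^sup>2 * (norm (u (Suc k)))\<^sup>2"
      using assms(7) grad[of "Suc k"] unfolding PL_inequality_def
      by (metis norm_scaleR power_mult_distrib power2_abs)
    then show "2 * q * F (Suc k) \<le> (norm (u (Suc k)))\<^sup>2"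
      using L by (simp add: F_def assms(8) field_simps power2_eq_square)
  qed
  have energy: "(1 + \<gamma>\<^sup>2) ^ k * E k \<le> F 0" for k
  proof (induction k)
    case 0
    then show ?case by (simp add: E_def p1)
  next
    case (Suc k)
    have "(1 + \<gamma>\<^sup>2) ^ k * ((1 + \<gamma>\<^sup>2) * E (Suc k)) \<le> (1 + \<gamma>\<^sup>2) ^ k * E k"
      using step pos by (intro mult_left_mono) auto
    with Suc show ?case by (simp add: mult_ac)
  qed
  have "f (y (Suc k)) - fstar \<le> (f (x 0) - fstar) / (1 + \<gamma>\<^sup>2) ^ k" for k
  proof -
    \<comment> \<open>Since \<open>y (Suc k)\<close> is the gradient step from \<open>x k\<close>,
      the descent lemma yields exactly the part of \<open>E k\<close> without momentum.\<close>
    have "f (y (Suc k)) \<le> f (x k) + inner (L *\<^sub>R u k) (- u k) + L / 2 * (norm (- u k))\<^sup>2"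
      using L_smooth_descent[OF assms(4), of "x k" "- u k"] by (simp add: ySuc grad)
    then have "f (y (Suc k)) - fstar \<le> L * (F k - (norm (u k))\<^sup>2 / 2)"
      using L by (simp add: F_def power2_norm_eq_inner[symmetric] right_diff_distrib
          diff_divide_distrib)
    also have "\<dots> \<le> L * E k" using L c by (intro mult_left_mono) (simp_all add: E_def)
    also have "\<dots> \<le> L * (F 0 / (1 + \<gamma>\<^sup>2) ^ k)"
      using L energy[of k] pos by (intro mult_left_mono) (simp_all add: pos_le_divide_eq mult.commute)
    finally show ?thesis using L by (simp add: F_def)
  qed
  \<comment> \<open>Bounding \<open>y (Suc k)\<close> by \<open>E k\<close> costs one index, hence
    the exponent -k + 1.\<close>
  then have "f (y k) - fstar \<le> (f (x 0) - fstar) * (1 + \<rho>) powi (- int k + 1)" if "k \<ge> 1" for k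
    using that by (cases k) (simp_all add: a power_int_minus divide_inverse)
  then show ?thesis by blast
qed

end
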